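(* Let $\alpha\colon U\subset\mathbb{R}^2\to S\subset\mathbb{R}^3$, $(u,v)\mapsto\alpha(u,v)$, be a local parametrization of a smooth surface $S$ without Euclidean parabolic points, let $\nu$ be its co-normal map, and let $S^{\nu}$ be the corresponding co-normal surface, parametrized by $\nu\colon U\to\mathbb{R}^3$. Let $\gamma\colon I\to U$, $\gamma(t)=(u(t),v(t))$, be a regular plane curve in the domain of $\alpha$. Then: (1) The curve $\beta=\alpha\circ\gamma$ is an affine asymptotic line of $S$ if and only if the curve $\eta=\nu\circ\gamma$ is an asymptotic line (in the Euclidean sense) of $S^{\nu}$. (2) A point $p\in S$ is an affine parabolic point of $S$ if and only if $\nu(p)$ is a (Euclidean) parabolic point of $S^{\nu}$.
   Context: For an immersion $\alpha\colon U\to\mathbb{R}^3$ put $L=\det(\alpha_u,\alpha_v,\alpha_{uu})$, $M=\det(\alpha_u,\alpha_v,\alpha_{uv})$, $N=\det(\alpha_u,\alpha_v,\alpha_{vv})$. A point is Euclidean parabolic if $LN-M^2=0$ there (i.e. the Gaussian curvature vanishes). At non-parabolic points the co-normal vector is $\nu=|LN-M^2|^{-1/4}\,(\alpha_u\wedge\alpha_v)$, where $\wedge$ is the vector product of $\mathbb{R}^3$. The affine normal $\xi$ is the vector field determined by $\langle\nu,\xi\rangle=1$ and $\langle\xi,\nu_u\rangle=\langle\xi,\nu_v\rangle=0$; its derivatives $\xi_u,\xi_v$ are tangent to $S$. The affine third fundamental form is $\mathrm{III}^{\mathrm{aff}}_\alpha(w)=\langle D\nu(w),D\xi(w)\rangle=l\,a^2+2m\,ab+n\,b^2$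 for $w=a\alpha_u+b\alpha_v$, with $l=\langle\nu_u,\xi_u\rangle$, $m=\langle\nu_u,\xi_v\rangle=\langle\nu_v,\xi_u\rangle$, $n=\langle\nu_v,\xi_v\rangle$. A nonzero tangent vector $w$ is an affine (Blaschke) asymptotic direction if $\mathrm{III}^{\mathrm{aff}}_\alpha(w)=0$. An affine asymptotic line is a regular curve on $S$ whose tangent at each point is an affine asymptotic direction, i.e. $l\,(u')^2+2m\,u'v'+n\,(v')^2=0$ along it. A point is affine parabolic if $\det D\xi=0$ there (determinant of the affine shape operator $D\xi\colon T_pS\to T_pS$), equivalently $ln-m^2=0$. The co-normal map is an immersion, so $S^{\nu}=\nu(U)$ is locally a regular surface. A (Euclidean) asymptotic line of $S^\nu$ is a regular curve along whose tangents the Euclidean second fundamental form of $S^\nu$ vanishes, and a parabolic point of $S^\nu$ is a point of zero Gaussian curvature. *)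

theory Defs
  imports "HOL-Analysis.Analysis"
begin

(* Meaningful for open U: the iterated derivatives at a point of U then depend on f near
   that point only. *)
fun Ck_on :: "nat \<Rightarrow> 'a::euclidean_space set \<Rightarrow> ('a \<Rightarrow> 'b::real_normed_vector) \<Rightarrow> bool" where
  "Ck_on 0 U f \<longleftrightarrow> continuous_on U f"
| "Ck_on (Suc k) U f \<longleftrightarrow> (\<forall>x\<in>U. f differentiable (at x)) \<and>
     (\<forall>v. Ck_on k U (\<lambda>x. frechet_derivative f (at x) v))"

definition smooth_on :: "'a::euclidean_space set \<Rightarrow> ('a \<Rightarrow> 'b::real_normed_vector) \<Rightarrow> bool" where
  "smooth_on U f \<longleftrightarrow> (\<forall>k. Ck_on k U f)"

definition immersion_on :: "(real^2) set \<Rightarrow> (real^2 \<Rightarrow> real^3) \<Rightarrow> bool" where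
  "immersion_on U x \<longleftrightarrow> (\<forall>q\<in>U. inj (frechet_derivative x (at q)))"

definition partial_deriv :: "2 \<Rightarrow> (real^2 \<Rightarrow> real^3) \<Rightarrow> real^2 \<Rightarrow> real^3" where
  "partial_deriv i f q = frechet_derivative f (at q) (axis i 1)"

abbreviation d_u :: "(real^2 \<Rightarrow> real^3) \<Rightarrow> real^2 \<Rightarrow> real^3" where
  "d_u \<equiv> partial_deriv 1"

abbreviation d_v :: "(real^2 \<Rightarrow> real^3) \<Rightarrow> real^2 \<Rightarrow> real^3" where
  "d_v \<equiv> partial_deriv 2"

(* The tangent vector w = a x_u + b x_v has the coordinates (a, b); they are unique where the
   differential of x is injective. *)
definition tangent_space :: "(real^2 \<Rightarrow> real^3) \<Rightarrow> real^2 \<Rightarrow> (real^3) set" where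
  "tangent_space x q = range (frechet_derivative x (at q))"

definition tangent_coords :: "(real^2 \<Rightarrow> real^3) \<Rightarrow> real^2 \<Rightarrow> real^3 \<Rightarrow> real^2" where
  "tangent_coords x q w = inv (frechet_derivative x (at q)) w"

(* The differential at x(q) of a vector field F along the surface x (F given as a function of
   the parameters), applied to a tangent vector: a x_u + b x_v is sent to a F_u + b F_v. *)
definition surface_diff ::
    "(real^2 \<Rightarrow> real^3) \<Rightarrow> (real^2 \<Rightarrow> real^3) \<Rightarrow> real^2 \<Rightarrow> real^3 \<Rightarrow> real^3" where
  "surface_diff x F q w = frechet_derivative F (at q) (tangent_coords x q w)"

(* One-sided derivatives are used at end points of I belonging to I. *)
definition regular_curve :: "real set \<Rightarrow> (real \<Rightarrow> 'a::real_normed_vector) \<Rightarrow> bool" where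
  "regular_curve I c \<longleftrightarrow>
     (\<forall>t\<in>I. c differentiable (at t within I)) \<and>
     continuous_on I (\<lambda>t. vector_derivative c (at t within I)) \<and>
     (\<forall>t\<in>I. vector_derivative c (at t within I) \<noteq> 0)"

definition L_coeff :: "(real^2 \<Rightarrow> real^3) \<Rightarrow> real^2 \<Rightarrow> real" where
  "L_coeff x q = det (vector [d_u x q, d_v x q, d_u (d_u x) q] :: real^3^3)"

definition M_coeff :: "(real^2 \<Rightarrow> real^3) \<Rightarrow> real^2 \<Rightarrow> real" where
  "M_coeff x q = det (vector [d_u x q, d_v x q, d_v (d_u x) q] :: real^3^3)"

definition N_coeff :: "(real^2 \<Rightarrow> real^3) \<Rightarrow> real^2 \<Rightarrow> real" where
  "N_coeff x q = det (vector [d_u x q, d_v x q, d_v (d_v x) q] :: real^3^3)"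

definition euclidean_parabolic :: "(real^2 \<Rightarrow> real^3) \<Rightarrow> real^2 \<Rightarrow> bool" where
  "euclidean_parabolic x q \<longleftrightarrow> L_coeff x q * N_coeff x q - (M_coeff x q)\<^sup>2 = 0"

definition unit_normal :: "(real^2 \<Rightarrow> real^3) \<Rightarrow> real^2 \<Rightarrow> real^3" where
  "unit_normal x q = sgn (cross3 (d_u x q) (d_v x q))"

definition second_fundamental_form :: "(real^2 \<Rightarrow> real^3) \<Rightarrow> real^2 \<Rightarrow> real^3 \<Rightarrow> real" where
  "second_fundamental_form x q w =
     (let a = tangent_coords x q w $ 1; b = tangent_coords x q w $ 2; n = unit_normal x q in
        (n \<bullet> d_u (d_u x) q) * a\<^sup>2 + 2 * (n \<bullet> d_v (d_u x) q) * a * b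
        + (n \<bullet> d_v (d_v x) q) * b\<^sup>2)"

definition gaussian_curvature :: "(real^2 \<Rightarrow> real^3) \<Rightarrow> real^2 \<Rightarrow> real" where
  "gaussian_curvature x q =
     (let n = unit_normal x q in
        ((n \<bullet> d_u (d_u x) q) * (n \<bullet> d_v (d_v x) q) - (n \<bullet> d_v (d_u x) q)\<^sup>2) /
        ((d_u x q \<bullet> d_u x q) * (d_v x q \<bullet> d_v x q) - (d_u x q \<bullet> d_v x q)\<^sup>2))"

definition asymptotic_direction :: "(real^2 \<Rightarrow> real^3) \<Rightarrow> real^2 \<Rightarrow> real^3 \<Rightarrow> bool" where
  "asymptotic_direction x q w \<longleftrightarrow>
     w \<in> tangent_space x q \<and> w \<noteq> 0 \<and> second_fundamental_form x q w = 0"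

(* The curve in question is x o c on the surface x. It is given by its parameter curve c, so
   that the sheet of the surface it lies on is known even where x is not injective. *)
definition asymptotic_line ::
    "(real^2 \<Rightarrow> real^3) \<Rightarrow> real set \<Rightarrow> (real \<Rightarrow> real^2) \<Rightarrow> bool" where
  "asymptotic_line x I c \<longleftrightarrow> regular_curve I (x \<circ> c) \<and>
     (\<forall>t\<in>I. asymptotic_direction x (c t) (vector_derivative (x \<circ> c) (at t within I)))"

definition conormal :: "(real^2 \<Rightarrow> real^3) \<Rightarrow> real^2 \<Rightarrow> real^3" where
  "conormal \<alpha> q = (\<bar>L_coeff \<alpha> q * N_coeff \<alpha> q - (M_coeff \<alpha> q)\<^sup>2\<bar> powr (- 1 / 4))
      *\<^sub>R cross3 (d_u \<alpha> q) (d_v \<alpha> q)"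

definition affine_normal :: "(real^2 \<Rightarrow> real^3) \<Rightarrow> real^2 \<Rightarrow> real^3" where
  "affine_normal \<alpha> q = (THE \<xi>. conormal \<alpha> q \<bullet> \<xi> = 1 \<and>
      \<xi> \<bullet> d_u (conormal \<alpha>) q = 0 \<and> \<xi> \<bullet> d_v (conormal \<alpha>) q = 0)"

definition affine_third_form :: "(real^2 \<Rightarrow> real^3) \<Rightarrow> real^2 \<Rightarrow> real^3 \<Rightarrow> real" where
  "affine_third_form \<alpha> q w =
     surface_diff \<alpha> (conormal \<alpha>) q w \<bullet> surface_diff \<alpha> (affine_normal \<alpha>) q w"

definition affine_asymptotic_direction :: "(real^2 \<Rightarrow> real^3) \<Rightarrow> real^2 \<Rightarrow> real^3 \<Rightarrow> bool" where
  "affine_asymptotic_direction \<alpha> q w \<longleftrightarrow>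
     w \<in> tangent_space \<alpha> q \<and> w \<noteq> 0 \<and> affine_third_form \<alpha> q w = 0"

definition affine_asymptotic_line ::
    "(real^2 \<Rightarrow> real^3) \<Rightarrow> real set \<Rightarrow> (real \<Rightarrow> real^2) \<Rightarrow> bool" where
  "affine_asymptotic_line \<alpha> I c \<longleftrightarrow> regular_curve I (\<alpha> \<circ> c) \<and>
     (\<forall>t\<in>I. affine_asymptotic_direction \<alpha> (c t) (vector_derivative (\<alpha> \<circ> c) (at t within I)))"

(* The matrix, with respect to the basis alpha_u, alpha_v of the tangent space, of the affine
   shape operator, which sends alpha_u to xi_u and alpha_v to xi_v. *)
definition affine_shape_matrix :: "(real^2 \<Rightarrow> real^3) \<Rightarrow> real^2 \<Rightarrow> real^2^2" where
  "affine_shape_matrix \<alpha> q =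
     matrix (\<lambda>h. tangent_coords \<alpha> q
       (surface_diff \<alpha> (affine_normal \<alpha>) q (frechet_derivative \<alpha> (at q) h)))"

definition affine_parabolic :: "(real^2 \<Rightarrow> real^3) \<Rightarrow> real^2 \<Rightarrow> bool" where
  "affine_parabolic \<alpha> q \<longleftrightarrow> det (affine_shape_matrix \<alpha> q) = 0"

end

(* The affine normal xi is orthogonal to nu_u and nu_v, so it is a Euclidean normal of the
   co-normal surface. Differentiating <xi, nu_i> = 0 gives <nu_i, xi_j> = - <xi, nu_ij>: the affine
   third fundamental form of S is a nonzero multiple of the Euclidean second fundamental form of
   the co-normal surface, in the same parameters. For the parabolic points,
   xi_u x xi_v = det(D xi) alpha_u x alpha_v is paired with nu_u x nu_v, where
   <nu_u x nu_v, alpha_u x alpha_v> = |LN - M^2|^(-1/2) (LN - M^2) is nonzero. *)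

theory Submission
  imports Defs
begin

section \<open>Smooth maps\<close>

text \<open>On an open set a derivative depends only on nearby values, so maps that agree on
  \<open>U\<close> have the same derivatives of every order there.\<close>

lemma Ck_on_cong:
  assumes "open U" "\<And>x. x \<in> U \<Longrightarrow> f x = g x"
  shows "Ck_on k U f \<longleftrightarrow> Ck_on k U g"
  using assms(2)
proof (induction k arbitrary: f g)
  case 0
  then show ?case using continuous_on_cong by force
next
  case (Suc k)
  have D: "f differentiable (at x) \<longleftrightarrow> g differentiable (at x)" if "x \<in> U" for x
    using that assms(1) Suc.prems has_derivative_transform_within_open
    unfolding differentiable_def by metis
  have E: "frechet_derivative f (at x) = frechet_derivative g (at x)"
    if "x \<in> U" "f differentiable (at x)" for x
    using frechet_derivative_transform_within_open[OF that(2) assms(1) that(1)] Suc.prems by blast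
  show ?case
  \<comment> \<open>\<open>frechet_derivative\<close> is a choice that means a derivative only for
    differentiable maps. If \<open>f\<close> is not differentiable at some point of
    \<open>U\<close>, neither is \<open>g\<close>, and both sides are false.\<close>
  proof (cases "\<forall>x\<in>U. f differentiable (at x)")
    case True
    then have "Ck_on k U (\<lambda>x. frechet_derivative f (at x) v) \<longleftrightarrow>
        Ck_on k U (\<lambda>x. frechet_derivative g (at x) v)" for v
      by (intro Suc.IH) (simp add: E)
    then show ?thesis using D by auto
  qed (use D in auto)
qed

lemma Ck_on_imp_continuous_on: "Ck_on k U f \<Longrightarrow> continuous_on U f"
  by (cases k) (auto intro!: differentiable_imp_continuous_on
      simp: differentiable_on_def differentiable_at_withinI)

lemma Ck_on_SucD: "Ck_on (Suc k) U f \<Longrightarrow> Ck_on k U f"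
proof (induction k arbitrary: f)
  case 0
  then show ?case using Ck_on_imp_continuous_on by (metis Ck_on.simps(1))
next
  case (Suc k)
  then show ?case by (metis Ck_on.simps(2))
qed

text \<open>With the derivative supplied explicitly by a rule of calculus, the inductions below need
  not evaluate \<open>frechet_derivative\<close> of a composite map.\<close>

lemma Ck_on_SucI:
  assumes "open U" and "\<And>x. x \<in> U \<Longrightarrow> (f has_derivative D x) (at x)"
    and "\<And>v. Ck_on k U (\<lambda>x. D x v)"
  shows "Ck_on (Suc k) U f"
proof -
  have "frechet_derivative f (at x) = D x" if "x \<in> U" for x
    using assms(2)[OF that] frechet_derivative_at by metis
  then have "Ck_on k U (\<lambda>x. frechet_derivative f (at x) v)" for v
    using assms(3)[of v] Ck_on_cong[OF assms(1), of "\<lambda>x. frechet_derivative f (at x) v" "\<lambda>x. D x v"]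
    by simp
  then show ?thesis using assms(2) by (auto simp: differentiable_def)
qed

lemma Ck_on_SucE:
  assumes "Ck_on (Suc k) U f" and "x \<in> U"
  shows "(f has_derivative frechet_derivative f (at x)) (at x)"
  using assms frechet_derivative_works by auto

lemma Ck_on_const: "open U \<Longrightarrow> Ck_on k U (\<lambda>x. c)"
proof (induction k arbitrary: c)
  case (Suc k)
  show ?case by (rule Ck_on_SucI[where D = "\<lambda>x v. 0"]) (use Suc in auto)
qed simp

lemma Ck_on_add:
  assumes "open U" "Ck_on k U f" "Ck_on k U g"
  shows "Ck_on k U (\<lambda>x. f x + g x)"
  using assms(2,3)
proof (induction k arbitrary: f g)
  case 0
  then show ?case by (simp add: continuous_on_add)
next
  case (Suc k)
  show ?case
    by (rule Ck_on_SucI[OF assms(1) has_derivative_add[OF Ck_on_SucE[OF Suc.prems(1)]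
            Ck_on_SucE[OF Suc.prems(2)]]])
      (use Suc in auto)
qed

text \<open>The product rule gives two terms of the same bilinear shape, each with one factor
  differentiated and the other lowered in order by \<open>Ck_on_SucD\<close>. Real products,
  scaling, inner products and cross products are all instances.\<close>

lemma Ck_on_bilinear:
  assumes "open U" "bounded_bilinear h" "Ck_on k U f" "Ck_on k U g"
  shows "Ck_on k U (\<lambda>x. h (f x) (g x))"
  using assms(3,4)
proof (induction k arbitrary: f g)
  case 0
  then show ?case by (simp add: bounded_bilinear.continuous_on[OF assms(2)])
next
  case (Suc k)
  show ?case
    by (rule Ck_on_SucI[OF assms(1) bounded_bilinear.FDERIV[OF assms(2)
            Ck_on_SucE[OF Suc.prems(1)] Ck_on_SucE[OF Suc.prems(2)]]])
      (use Suc Ck_on_SucD[OF Suc.prems(1)] Ck_on_SucD[OF Suc.prems(2)]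
        in \<open>auto intro!: Ck_on_add assms(1)\<close>)
qed

text \<open>Differentiation lowers the exponent by one, so the induction ranges over all exponents
  \<open>a\<close>. Positivity of \<open>f\<close> makes the power differentiable.\<close>

lemma Ck_on_powr:
  fixes f :: "'a::euclidean_space \<Rightarrow> real"
  assumes "open U" "\<And>x. x \<in> U \<Longrightarrow> 0 < f x" "Ck_on k U f"
  shows "Ck_on k U (\<lambda>x. f x powr a)"
  using assms(3)
proof (induction k arbitrary: a)
  case 0
  then show ?case using assms(2)
    by (auto intro!: continuous_on_powr continuous_on_const simp: less_imp_neq[symmetric])
next
  case (Suc k)
  let ?D = "\<lambda>x v. (a * f x powr (a - 1)) * frechet_derivative f (at x) v"
  have "((\<lambda>x. f x powr a) has_derivative ?D x) (at x)" if "x \<in> U" for x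
  proof -
    have "((\<lambda>y. y powr a) has_real_derivative a * f x powr (a - 1)) (at (f x))"
      using assms(2)[OF that] by (rule has_real_derivative_powr)
    from has_derivative_compose[OF Ck_on_SucE[OF Suc.prems that]
        this[unfolded has_field_derivative_def]]
    show ?thesis .
  qed
  moreover have "Ck_on k U (\<lambda>x. ?D x v)" for v
    using Suc.prems Ck_on_SucD[OF Suc.prems] Suc.IH[of "a - 1"]
    by (auto intro!: Ck_on_bilinear[OF assms(1) bounded_bilinear_mult] Ck_on_const assms(1))
  ultimately show ?case by (rule Ck_on_SucI[OF assms(1)])
qed

section \<open>Closure properties of smooth maps\<close>

lemma smooth_on_cong:
  "open U \<Longrightarrow> (\<And>x. x \<in> U \<Longrightarrow> f x = g x) \<Longrightarrow> smooth_on U f \<longleftrightarrow> smooth_on U g"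
  unfolding smooth_on_def using Ck_on_cong by blast

lemma smooth_on_bilinear:
  "open U \<Longrightarrow> bounded_bilinear h \<Longrightarrow> smooth_on U f \<Longrightarrow> smooth_on U g \<Longrightarrow>
    smooth_on U (\<lambda>x. h (f x) (g x))"
  unfolding smooth_on_def using Ck_on_bilinear by blast

lemmas smooth_on_mult = smooth_on_bilinear[OF _ bounded_bilinear_mult]
  and smooth_on_scaleR = smooth_on_bilinear[OF _ bounded_bilinear_scaleR]
  and smooth_on_inner = smooth_on_bilinear[OF _ bounded_bilinear_inner]

lemma smooth_on_cross3:
  "open U \<Longrightarrow> smooth_on U f \<Longrightarrow> smooth_on U g \<Longrightarrow> smooth_on U (\<lambda>x. cross3 (f x) (g x))"
  using smooth_on_bilinear bilinear_cross bilinear_conv_bounded_bilinear by blast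

lemma smooth_on_const: "open U \<Longrightarrow> smooth_on U (\<lambda>x. c)"
  unfolding smooth_on_def using Ck_on_const by blast

lemma smooth_on_diff:
  assumes "open U" "smooth_on U f" "smooth_on U g"
  shows "smooth_on U (\<lambda>x. f x - g x)"
proof -
  have "smooth_on U (\<lambda>x. (- 1::real) *\<^sub>R g x)"
    by (intro smooth_on_scaleR smooth_on_const assms)
  then have "smooth_on U (\<lambda>x. f x + (- 1::real) *\<^sub>R g x)"
    using assms Ck_on_add unfolding smooth_on_def by blast
  then show ?thesis by simp
qed

lemma smooth_on_powr:
  fixes f :: "'a::euclidean_space \<Rightarrow> real"
  shows "open U \<Longrightarrow> (\<And>x. x \<in> U \<Longrightarrow> 0 < f x) \<Longrightarrow> smooth_on U f \<Longrightarrow> smooth_on U (\<lambda>x. f x powr a)"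
  unfolding smooth_on_def using Ck_on_powr by blast

lemma smooth_on_frechet_derivative:
  "smooth_on U f \<Longrightarrow> smooth_on U (\<lambda>x. frechet_derivative f (at x) v)"
  unfolding smooth_on_def by (metis Ck_on.simps(2))

lemma smooth_on_partial_deriv: "smooth_on U f \<Longrightarrow> smooth_on U (partial_deriv i f)"
  using smooth_on_frechet_derivative[of U f "axis i 1"] by (simp add: partial_deriv_def[abs_def])

lemma smooth_on_imp_has_derivative:
  "smooth_on U f \<Longrightarrow> x \<in> U \<Longrightarrow> (f has_derivative frechet_derivative f (at x)) (at x)"
  unfolding smooth_on_def using Ck_on_SucE by blast

lemma smooth_on_imp_differentiable: "smooth_on U f \<Longrightarrow> x \<in> U \<Longrightarrow> f differentiable (at x)"
  using smooth_on_imp_has_derivative differentiable_def by blast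

lemma smooth_on_imp_continuous_on: "smooth_on U f \<Longrightarrow> continuous_on U f"
  unfolding smooth_on_def using Ck_on_imp_continuous_on by blast

section \<open>Symmetry of second derivatives\<close>

text \<open>The chain rule on a line, through which the one-variable mean value theorem applies in
  several variables.\<close>

lemma frechet_derivative_along_line:
  assumes "f differentiable (at (a + s *\<^sub>R v))"
  shows "((\<lambda>s. f (a + s *\<^sub>R v)) has_derivative
    (\<lambda>r. r *\<^sub>R frechet_derivative f (at (a + s *\<^sub>R v)) v)) (at s)"
proof -
  have "((\<lambda>s. a + s *\<^sub>R v) has_derivative (\<lambda>r. r *\<^sub>R v)) (at s)"
    by (auto intro!: derivative_eq_intros)
  from has_derivative_compose[OF this frechet_derivative_works[THEN iffD1, OF assms]]
  show ?thesis
    using linear_cmul[OF linear_frechet_derivative[OF assms]] by simp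
qed

text \<open>The mean value theorem, used first along \<open>v\<close> and then along
  \<open>w\<close>, turns the quotient into the mixed derivative at a point near \<open>x\<close>;
  continuity of that derivative gives the limit.\<close>

lemma second_difference_quotient_tendsto:
  fixes f :: "'a::euclidean_space \<Rightarrow> real"
  assumes "open U" "smooth_on U f" "x \<in> U"
  shows "((\<lambda>h. (f (x + h *\<^sub>R v + h *\<^sub>R w) - f (x + h *\<^sub>R v) - f (x + h *\<^sub>R w) + f x) / h\<^sup>2) \<longlongrightarrow>
    frechet_derivative (\<lambda>y. frechet_derivative f (at y) v) (at x) w) (at_right 0)"
proof (rule tendstoI)
  fix e :: real assume "0 < e"
  define F where "F y = frechet_derivative f (at y) v" for y
  define P where "P y = frechet_derivative F (at y) w" for y
  have sF: "smooth_on U F"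
    unfolding F_def[abs_def] by (rule smooth_on_frechet_derivative[OF assms(2)])
  have sP: "smooth_on U P"
    unfolding P_def[abs_def] by (rule smooth_on_frechet_derivative[OF sF])
  obtain d where d: "0 < d" "ball x d \<subseteq> U" "\<And>y. y \<in> ball x d \<Longrightarrow> dist (P y) (P x) < e"
  proof -
    obtain d1 where d1: "0 < d1" "\<And>y. y \<in> U \<Longrightarrow> dist y x < d1 \<Longrightarrow> dist (P y) (P x) < e"
      using smooth_on_imp_continuous_on[OF sP] assms(3) \<open>0 < e\<close>
      unfolding continuous_on_iff by meson
    obtain d2 where d2: "0 < d2" "ball x d2 \<subseteq> U"
      using assms(1,3) openE by blast
    show thesis
      by (rule that[of "min d1 d2"]) (use d1 d2 in \<open>auto simp: dist_commute subset_iff\<close>)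
  qed
  \<comment> \<open>For \<open>s\<close> and \<open>t\<close> in the interval from 0 to
    \<open>b\<close>, the displacement along \<open>v\<close> and \<open>w\<close> stays shorter
    than \<open>d\<close>. The summand 1 keeps the denominator positive when both vectors
    vanish.\<close>
  define b where "b = d / (norm v + norm w + 1)"
  have "0 < b" using d(1) unfolding b_def by (simp add: add_nonneg_pos)
  have in_ball: "x + s *\<^sub>R v + t *\<^sub>R w \<in> ball x d" if "0 \<le> s" "s < b" "0 \<le> t" "t < b" for s t
  proof -
    have "norm (s *\<^sub>R v + t *\<^sub>R w) \<le> s * norm v + t * norm w"
      using norm_triangle_ineq[of "s *\<^sub>R v" "t *\<^sub>R w"] that by simp
    also have "\<dots> \<le> b * norm v + b * norm w"
      using that by (intro add_mono mult_right_mono) auto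
    also have "\<dots> < b * (norm v + norm w + 1)"
      using \<open>0 < b\<close> by (simp add: algebra_simps)
    also have "\<dots> = d" unfolding b_def by (simp add: add_nonneg_pos less_imp_neq[symmetric])
    finally show ?thesis
      unfolding mem_ball dist_commute[of x "x + s *\<^sub>R v + t *\<^sub>R w"] by (simp add: dist_norm add.assoc)
  qed
  have "dist ((f (x + h *\<^sub>R v + h *\<^sub>R w) - f (x + h *\<^sub>R v) - f (x + h *\<^sub>R w) + f x) / h\<^sup>2) (P x) < e"
    if h: "0 < h" "h < b" for h
  proof -
    \<comment> \<open>\<open>g\<close> is the increment of \<open>f\<close> in the direction
      \<open>w\<close>, so the second difference is \<open>g h - g 0\<close>. Its derivative is an
      increment of \<open>F\<close>, to which the mean value theorem applies again.\<close>
    define g where "g s = f (x + h *\<^sub>R w + s *\<^sub>R v) - f (x + s *\<^sub>R v)" for s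
    have *: "(g has_derivative (\<lambda>r. r *\<^sub>R F (x + h *\<^sub>R w + s *\<^sub>R v) - r *\<^sub>R F (x + s *\<^sub>R v))) (at s)"
      if "0 \<le> s" "s \<le> h" for s
    proof -
      have "x + h *\<^sub>R w + s *\<^sub>R v \<in> U" "x + s *\<^sub>R v \<in> U"
        using in_ball[of s h] in_ball[of s 0] d(2) h that by (auto simp: add_ac)
      then show ?thesis unfolding g_def[abs_def] F_def
        by (intro has_derivative_diff frechet_derivative_along_line
            smooth_on_imp_differentiable[OF assms(2)])
    qed
    obtain s where s: "0 < s" "s < h"
      "g h - g 0 = h * (F (x + s *\<^sub>R v + h *\<^sub>R w) - F (x + s *\<^sub>R v))"
      using mvt_simple[OF h(1), of g, OF has_derivative_at_withinI[OF *]]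
      by (auto simp: algebra_simps)
    have **: "((\<lambda>t. F (x + s *\<^sub>R v + t *\<^sub>R w)) has_derivative (\<lambda>r. r *\<^sub>R P (x + s *\<^sub>R v + t *\<^sub>R w))) (at t)"
      if "0 \<le> t" "t \<le> h" for t
      unfolding P_def using in_ball[of s t] d(2) h s that
      by (intro frechet_derivative_along_line smooth_on_imp_differentiable[OF sF]) auto
    obtain t where t: "0 < t" "t < h"
      "F (x + s *\<^sub>R v + h *\<^sub>R w) - F (x + s *\<^sub>R v) = h * P (x + s *\<^sub>R v + t *\<^sub>R w)"
      using mvt_simple[OF h(1), of "\<lambda>t. F (x + s *\<^sub>R v + t *\<^sub>R w)", OF has_derivative_at_withinI[OF **]]
      by auto
    have "f (x + h *\<^sub>R v + h *\<^sub>R w) - f (x + h *\<^sub>R v) - f (x + h *\<^sub>R w) + f x = g h - g 0"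
      unfolding g_def by (simp add: add_ac)
    then have "(f (x + h *\<^sub>R v + h *\<^sub>R w) - f (x + h *\<^sub>R v) - f (x + h *\<^sub>R w) + f x) / h\<^sup>2
        = P (x + s *\<^sub>R v + t *\<^sub>R w)"
      using s(3) t(3) h(1) by (simp add: power2_eq_square)
    then show ?thesis using d(3)[OF in_ball[of s t]] s t h by simp
  qed
  then show "\<forall>\<^sub>F h in at_right 0. dist ((f (x + h *\<^sub>R v + h *\<^sub>R w) - f (x + h *\<^sub>R v) - f (x + h *\<^sub>R w) + f x) / h\<^sup>2)
      (frechet_derivative (\<lambda>y. frechet_derivative f (at y) v) (at x) w) < e"
    unfolding P_def F_def eventually_at_right_field using \<open>0 < b\<close> by blast
qed

lemma frechet_derivative_inner_const:
  assumes "f differentiable (at x)"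
  shows "frechet_derivative (\<lambda>y. f y \<bullet> b) (at x) = (\<lambda>v. frechet_derivative f (at x) v \<bullet> b)"
  by (rule frechet_derivative_at[symmetric])
    (use assms in \<open>auto intro!: has_derivative_inner_left simp: frechet_derivative_works\<close>)

text \<open>The second difference is unchanged when \<open>v\<close> and \<open>w\<close> are
  swapped, so both mixed derivatives are limits of the same quotient. That limit is known for
  real-valued maps, hence the passage to components.\<close>

lemma second_derivative_symmetric:
  fixes f :: "'a::euclidean_space \<Rightarrow> 'b::euclidean_space"
  assumes "open U" "smooth_on U f" "x \<in> U"
  shows "frechet_derivative (\<lambda>y. frechet_derivative f (at y) v) (at x) w
    = frechet_derivative (\<lambda>y. frechet_derivative f (at y) w) (at x) v"
proof (rule euclidean_eqI)
  fix b :: 'b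
  define g where "g y = f y \<bullet> b" for y
  have sg: "smooth_on U g"
    unfolding g_def[abs_def] by (intro smooth_on_inner smooth_on_const assms)
  have Dg: "frechet_derivative (\<lambda>y. frechet_derivative f (at y) v) (at x) w \<bullet> b
      = frechet_derivative (\<lambda>y. frechet_derivative g (at y) v) (at x) w" for v w
  proof -
    have "frechet_derivative (\<lambda>y. frechet_derivative f (at y) v) (at x) w \<bullet> b
        = frechet_derivative (\<lambda>y. frechet_derivative f (at y) v \<bullet> b) (at x) w"
      using frechet_derivative_inner_const[of "\<lambda>y. frechet_derivative f (at y) v" x b]
        smooth_on_imp_differentiable[OF smooth_on_frechet_derivative[OF assms(2)] assms(3)]
      by metis
    \<comment> \<open>The two functions of \<open>y\<close> are known to agree on \<open>U\<close>,
      which determines the derivatives at \<open>x\<close> because \<open>U\<close> is open.\<close>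
    also have "frechet_derivative (\<lambda>y. frechet_derivative f (at y) v \<bullet> b) (at x)
        = frechet_derivative (\<lambda>y. frechet_derivative g (at y) v) (at x)"
    proof (rule frechet_derivative_transform_within_open[OF _ assms(1,3)])
      show "(\<lambda>y. frechet_derivative f (at y) v \<bullet> b) differentiable at x"
        by (intro smooth_on_imp_differentiable[of U] smooth_on_inner smooth_on_const
            smooth_on_frechet_derivative assms)
      show "frechet_derivative f (at y) v \<bullet> b = frechet_derivative g (at y) v" if "y \<in> U" for y
        unfolding g_def[abs_def]
        using frechet_derivative_inner_const[OF smooth_on_imp_differentiable[OF assms(2) that]]
        by metis
    qed
    finally show ?thesis .
  qed
  have "((\<lambda>h. (g (x + h *\<^sub>R v + h *\<^sub>R w) - g (x + h *\<^sub>R v) - g (x + h *\<^sub>R w) + g x) / h\<^sup>2) \<longlongrightarrow>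
    frechet_derivative (\<lambda>y. frechet_derivative g (at y) w) (at x) v) (at_right 0)"
    using second_difference_quotient_tendsto[OF assms(1) sg assms(3), of w v]
    by (simp add: algebra_simps)
  then show "frechet_derivative (\<lambda>y. frechet_derivative f (at y) v) (at x) w \<bullet> b
    = frechet_derivative (\<lambda>y. frechet_derivative f (at y) w) (at x) v \<bullet> b"
    unfolding Dg using second_difference_quotient_tendsto[OF assms(1) sg assms(3), of v w]
    by (intro tendsto_unique[OF _ _]) auto
qed

lemma partial_deriv_commute:
  "open U \<Longrightarrow> smooth_on U f \<Longrightarrow> q \<in> U \<Longrightarrow>
    partial_deriv i (partial_deriv j f) q = partial_deriv j (partial_deriv i f) q"
  using second_derivative_symmetric[of U f q "axis j 1" "axis i 1"]
  by (simp add: partial_deriv_def[abs_def])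

section \<open>Linear algebra in dimensions two and three\<close>

lemma frechet_derivative_real2:
  fixes f :: "real^2 \<Rightarrow> real^3"
  assumes "f differentiable (at q)"
  shows "frechet_derivative f (at q) h = h $ 1 *\<^sub>R d_u f q + h $ 2 *\<^sub>R d_v f q"
proof -
  note lin = linear_frechet_derivative[OF assms]
  have "h = h $ 1 *\<^sub>R axis 1 1 + h $ 2 *\<^sub>R axis 2 1"
    by (simp add: vec_eq_iff forall_2 axis_def)
  then have "frechet_derivative f (at q) h
      = frechet_derivative f (at q) (h $ 1 *\<^sub>R axis 1 1 + h $ 2 *\<^sub>R axis 2 1)" by simp
  also have "\<dots> = h $ 1 *\<^sub>R d_u f q + h $ 2 *\<^sub>R d_v f q"
    unfolding partial_deriv_def linear_add[OF lin] linear_cmul[OF lin] ..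
  finally show ?thesis .
qed

text \<open>Up to the triple product as a factor, \<open>z\<close> is a combination of b x c, c x a
  and a x b with coefficients <z,a>, <z,b>, <z,c>. This gives the uniqueness of the affine
  normal.\<close>

lemma eq_0_if_orthogonal_independent:
  fixes a b c z :: "real^3"
  assumes "a \<bullet> cross3 b c \<noteq> 0" "z \<bullet> a = 0" "z \<bullet> b = 0" "z \<bullet> c = 0"
  shows "z = 0"
proof -
  have "(a \<bullet> cross3 b c) *\<^sub>R z
      = (z \<bullet> a) *\<^sub>R cross3 b c + (z \<bullet> b) *\<^sub>R cross3 c a + (z \<bullet> c) *\<^sub>R cross3 a b"
    by (simp add: cross3_simps forall_3)
  then show ?thesis using assms by simp
qed

text \<open>Cramer's rule in the basis a, b, a x b, where the coefficient along a x b vanishes by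
  assumption. It serves to write xi_u and xi_v in the basis alpha_u, alpha_v.\<close>

lemma orthogonal_cross3_in_span:
  fixes a b w :: "real^3"
  assumes "cross3 a b \<noteq> 0" "w \<bullet> cross3 a b = 0"
  obtains s t where "w = s *\<^sub>R a + t *\<^sub>R b"
proof -
  let ?c = "cross3 a b \<bullet> cross3 a b"
  have "?c *\<^sub>R w = (cross3 w b \<bullet> cross3 a b) *\<^sub>R a + (cross3 a w \<bullet> cross3 a b) *\<^sub>R b
      + (w \<bullet> cross3 a b) *\<^sub>R cross3 a b"
    by (simp add: cross3_simps forall_3)
  then have "?c *\<^sub>R w = (cross3 w b \<bullet> cross3 a b) *\<^sub>R a + (cross3 a w \<bullet> cross3 a b) *\<^sub>R b"
    using assms(2) by simp
  then have "(1 / ?c) *\<^sub>R (?c *\<^sub>R w)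
      = (1 / ?c) *\<^sub>R ((cross3 w b \<bullet> cross3 a b) *\<^sub>R a + (cross3 a w \<bullet> cross3 a b) *\<^sub>R b)" by simp
  then have "w = (cross3 w b \<bullet> cross3 a b / ?c) *\<^sub>R a + (cross3 a w \<bullet> cross3 a b / ?c) *\<^sub>R b"
    using assms(1) by (simp add: scaleR_add_right)
  then show thesis by (rule that)
qed

lemma cross3_linear_combinations:
  fixes a b :: "real^3"
  shows "cross3 (p *\<^sub>R a + r *\<^sub>R b) (s *\<^sub>R a + t *\<^sub>R b) = (p * t - r * s) *\<^sub>R cross3 a b"
  by (simp add: cross3_simps forall_3)

text \<open>The cross product with one partial derivative isolates the coefficient of the
  other.\<close>

lemma inj_frechet_derivative_if_cross3:
  fixes f :: "real^2 \<Rightarrow> real^3"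
  assumes "f differentiable (at q)" "cross3 (d_u f q) (d_v f q) \<noteq> 0"
  shows "inj (frechet_derivative f (at q))"
  unfolding linear_injective_0[OF linear_frechet_derivative[OF assms(1)]]
proof (intro allI impI)
  fix h assume "frechet_derivative f (at q) h = 0"
  then have *: "h $ 1 *\<^sub>R d_u f q + h $ 2 *\<^sub>R d_v f q = 0"
    unfolding frechet_derivative_real2[OF assms(1)] .
  have "cross3 (h $ 1 *\<^sub>R d_u f q + h $ 2 *\<^sub>R d_v f q) (d_v f q) = h $ 1 *\<^sub>R cross3 (d_u f q) (d_v f q)"
    "cross3 (d_u f q) (h $ 1 *\<^sub>R d_u f q + h $ 2 *\<^sub>R d_v f q) = h $ 2 *\<^sub>R cross3 (d_u f q) (d_v f q)"
    by (simp_all add: cross_add_left cross_add_right cross_mult_left cross_mult_right)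
  then have "h $ 1 = 0" "h $ 2 = 0" using assms(2) unfolding * by simp_all
  then show "h = 0" by (simp add: vec_eq_iff forall_2)
qed

lemma tangent_coords_frechet_derivative:
  "inj (frechet_derivative f (at q)) \<Longrightarrow> tangent_coords f q (frechet_derivative f (at q) h) = h"
  unfolding tangent_coords_def by simp

text \<open>The product rule for a constant inner product. It is applied to <nu, alpha_j> = 0, <xi,
  nu_i> = 0 and <nu, xi> = 1.\<close>

lemma partial_deriv_inner_const:
  assumes "open U" "smooth_on U f" "smooth_on U g" "q \<in> U" "\<And>x. x \<in> U \<Longrightarrow> f x \<bullet> g x = c"
  shows "partial_deriv i f q \<bullet> g q = - (f q \<bullet> partial_deriv i g q)"
proof -
  have "((\<lambda>x. f x \<bullet> g x) has_derivative (\<lambda>v. f q \<bullet> frechet_derivative g (at q) v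
      + frechet_derivative f (at q) v \<bullet> g q)) (at q)"
    by (intro has_derivative_inner smooth_on_imp_has_derivative[OF _ assms(4)] assms(2,3))
  moreover have "((\<lambda>x. f x \<bullet> g x) has_derivative (\<lambda>v. 0)) (at q)"
    by (rule has_derivative_transform_within_open[OF has_derivative_const assms(1,4)])
      (simp add: assms(5))
  ultimately have "(\<lambda>v. f q \<bullet> frechet_derivative g (at q) v
      + frechet_derivative f (at q) v \<bullet> g q) = (\<lambda>v. 0)"
    by (rule has_derivative_unique)
  then show ?thesis unfolding partial_deriv_def by (metis add_eq_0_iff)
qed

section \<open>Curves on immersed surfaces\<close>

text \<open>A connected set with more than one point has no isolated points. Vector derivatives
  within \<open>I\<close> are therefore unique, also at end points.\<close>

lemma interval_at_within_neq_bot: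
  fixes I :: "real set"
  assumes "is_interval I" "interior I \<noteq> {}" "t \<in> I"
  shows "at t within I \<noteq> bot"
proof -
  have "I \<noteq> {s}" for s using assms(2) by auto
  then have "t islimpt I"
    using connected_imp_perfect[OF is_interval_connected[OF assms(1)] assms(3)] by blast
  then show ?thesis by (simp add: trivial_limit_within)
qed

lemma vector_derivative_surface_curve:
  fixes I :: "real set" and f :: "real^2 \<Rightarrow> real^3"
  assumes "is_interval I" "interior I \<noteq> {}" "smooth_on U f" "\<gamma> ` I \<subseteq> U" "regular_curve I \<gamma>" "t \<in> I"
  shows "((f \<circ> \<gamma>) has_vector_derivative
      frechet_derivative f (at (\<gamma> t)) (vector_derivative \<gamma> (at t within I))) (at t within I)"
    and "vector_derivative (f \<circ> \<gamma>) (at t within I)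
      = frechet_derivative f (at (\<gamma> t)) (vector_derivative \<gamma> (at t within I))"
proof -
  have "(\<gamma> has_vector_derivative vector_derivative \<gamma> (at t within I)) (at t within I)"
    using assms(5,6) unfolding regular_curve_def by (simp add: vector_derivative_works[symmetric])
  moreover have "(f has_derivative frechet_derivative f (at (\<gamma> t))) (at (\<gamma> t) within \<gamma> ` I)"
    using smooth_on_imp_has_derivative[OF assms(3)] assms(4,6)
    by (blast intro: has_derivative_at_withinI)
  ultimately show *: "((f \<circ> \<gamma>) has_vector_derivative
      frechet_derivative f (at (\<gamma> t)) (vector_derivative \<gamma> (at t within I))) (at t within I)"
    by (rule vector_derivative_diff_chain_within)
  show "vector_derivative (f \<circ> \<gamma>) (at t within I)
      = frechet_derivative f (at (\<gamma> t)) (vector_derivative \<gamma> (at t within I))"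
    by (rule vector_derivative_within[OF interval_at_within_neq_bot[OF assms(1,2,6)] *])
qed

text \<open>An injective differential sends the nonzero velocity of \<open>\<gamma>\<close> to a
  nonzero vector.\<close>

lemma regular_curve_immersion:
  fixes I :: "real set" and f :: "real^2 \<Rightarrow> real^3"
  assumes "is_interval I" "interior I \<noteq> {}" "smooth_on U f" "immersion_on U f"
    "\<gamma> ` I \<subseteq> U" "regular_curve I \<gamma>"
  shows "regular_curve I (f \<circ> \<gamma>)"
  unfolding regular_curve_def
proof (intro conjI ballI)
  let ?v = "\<lambda>t. vector_derivative \<gamma> (at t within I)"
  note vd = vector_derivative_surface_curve[OF assms(1-3,5,6)]
  show "f \<circ> \<gamma> differentiable (at t within I)" if "t \<in> I" for t
    using vd(1)[OF that] unfolding has_vector_derivative_def differentiable_def by blast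
  have \<gamma>: "continuous_on I \<gamma>" "continuous_on I ?v"
    using assms(6) unfolding regular_curve_def
    by (auto intro!: differentiable_imp_continuous_on simp: differentiable_on_def)
  \<comment> \<open>The image velocity is a moving differential applied to a moving vector; its
    expansion in partial derivatives reduces continuity to that of the coefficients.\<close>
  have "continuous_on I (\<lambda>t. partial_deriv i f (\<gamma> t))" for i
    using continuous_on_compose2[OF smooth_on_imp_continuous_on[OF smooth_on_partial_deriv[OF assms(3)]]
        \<gamma>(1) assms(5)] .
  then have "continuous_on I (\<lambda>t. ?v t $ 1 *\<^sub>R d_u f (\<gamma> t) + ?v t $ 2 *\<^sub>R d_v f (\<gamma> t))"
    using \<gamma>(2) by (intro continuous_intros)
  moreover have "vector_derivative (f \<circ> \<gamma>) (at t within I)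
      = ?v t $ 1 *\<^sub>R d_u f (\<gamma> t) + ?v t $ 2 *\<^sub>R d_v f (\<gamma> t)" if "t \<in> I" for t
    unfolding vd(2)[OF that]
    by (rule frechet_derivative_real2) (use smooth_on_imp_differentiable assms(3,5) that in blast)
  ultimately show "continuous_on I (\<lambda>t. vector_derivative (f \<circ> \<gamma>) (at t within I))"
    by (subst continuous_on_cong[OF refl])
  show "vector_derivative (f \<circ> \<gamma>) (at t within I) \<noteq> 0" if "t \<in> I" for t
  proof -
    have "\<gamma> t \<in> U" "?v t \<noteq> 0" using that assms(5,6) unfolding regular_curve_def by auto
    then show ?thesis unfolding vd(2)[OF that]
      using assms(4) linear_injective_0[OF linear_frechet_derivative[OF
            smooth_on_imp_differentiable[OF assms(3) \<open>\<gamma> t \<in> U\<close>]]]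
      unfolding immersion_on_def by blast
  qed
qed

section \<open>The co-normal surface\<close>

locale nonparabolic_surface =
  fixes U :: "(real^2) set" and \<alpha> :: "real^2 \<Rightarrow> real^3"
  assumes open_domain: "open U" and smooth: "smooth_on U \<alpha>" and immersion: "immersion_on U \<alpha>"
    and nonparabolic: "\<And>q. q \<in> U \<Longrightarrow> \<not> euclidean_parabolic \<alpha> q"
begin

abbreviation "\<nu> \<equiv> conormal \<alpha>"
abbreviation "\<xi> \<equiv> affine_normal \<alpha>"
text \<open>\<open>K\<close> is the Gaussian curvature of \<open>\<alpha>\<close> times the fourth
  power of |alpha_u x alpha_v|.\<close>

abbreviation "K q \<equiv> L_coeff \<alpha> q * N_coeff \<alpha> q - (M_coeff \<alpha> q)\<^sup>2"
abbreviation "\<phi> q \<equiv> \<bar>K q\<bar> powr (- 1 / 4)"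

lemma coeff_eq:
  "L_coeff \<alpha> q = cross3 (d_u \<alpha> q) (d_v \<alpha> q) \<bullet> d_u (d_u \<alpha>) q"
  "M_coeff \<alpha> q = cross3 (d_u \<alpha> q) (d_v \<alpha> q) \<bullet> d_v (d_u \<alpha>) q"
  "N_coeff \<alpha> q = cross3 (d_u \<alpha> q) (d_v \<alpha> q) \<bullet> d_v (d_v \<alpha>) q"
  unfolding L_coeff_def M_coeff_def N_coeff_def dot_cross_det[symmetric]
  using cross_triple inner_commute by metis+

lemma K_nonzero: "q \<in> U \<Longrightarrow> K q \<noteq> 0"
  using nonparabolic unfolding euclidean_parabolic_def by blast

lemma smooth_K: "smooth_on U K"
  unfolding coeff_eq power2_eq_square
  by (intro smooth_on_diff smooth_on_mult smooth_on_inner smooth_on_cross3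
      smooth_on_partial_deriv open_domain smooth)

lemma smooth_conormal: "smooth_on U \<nu>"
proof -
  \<comment> \<open>The absolute value is traded for a square, since the rule for powers needs a
    smooth positive base.\<close>
  have "\<bar>x\<bar> powr (- 1 / 4) = (x * x) powr (- 1 / 8)" if "x \<noteq> 0" for x :: real
    using powr_powr[of "\<bar>x\<bar>" 2 "- 1 / 8"] that by (simp add: power2_eq_square)
  then have "smooth_on U \<phi> \<longleftrightarrow> smooth_on U (\<lambda>q. (K q * K q) powr (- 1 / 8))"
    using K_nonzero by (intro smooth_on_cong open_domain) blast
  moreover have "0 < K q * K q" if "q \<in> U" for q
    using K_nonzero[OF that] zero_less_mult_iff[of "K q" "K q"] by linarith
  then have "smooth_on U (\<lambda>q. (K q * K q) powr (- 1 / 8))"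
    by (intro smooth_on_powr smooth_on_mult smooth_K open_domain)
  ultimately have "smooth_on U \<phi>" by blast
  then show ?thesis unfolding conormal_def[abs_def]
    by (intro smooth_on_scaleR smooth_on_cross3 smooth_on_partial_deriv open_domain smooth)
qed

section \<open>Derivatives of the co-normal map\<close>

lemma conormal_orthogonal: "\<nu> q \<bullet> d_u \<alpha> q = 0" "\<nu> q \<bullet> d_v \<alpha> q = 0"
  unfolding conormal_def by (simp_all add: dot_cross_self inner_commute)

text \<open>Differentiate <nu, alpha_j> = 0. The resulting products are -\<open>\<phi>\<close> times
  L, M and N.\<close>

lemma deriv_conormal_inner:
  assumes "q \<in> U"
  shows "partial_deriv i \<nu> q \<bullet> partial_deriv j \<alpha> q = - (\<nu> q \<bullet> partial_deriv i (partial_deriv j \<alpha>) q)"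
proof (rule partial_deriv_inner_const[OF open_domain smooth_conormal smooth_on_partial_deriv[OF smooth] assms])
  show "\<nu> x \<bullet> partial_deriv j \<alpha> x = 0" for x
    using conormal_orthogonal exhaust_2[of j] by auto
qed

text \<open>By Lagrange's identity the left side is the determinant of the products <nu_i, alpha_j>,
  that is, of -\<open>\<phi>\<close> times the symmetric matrix with entries L, M, M, N.\<close>

lemma cross_conormal_dot_cross:
  assumes "q \<in> U"
  shows "cross3 (d_u \<nu> q) (d_v \<nu> q) \<bullet> cross3 (d_u \<alpha> q) (d_v \<alpha> q) = (\<phi> q)\<^sup>2 * K q"
  unfolding dot_cross deriv_conormal_inner[OF assms]
    partial_deriv_commute[OF open_domain smooth assms, of 1 2]
  unfolding conormal_def inner_scaleR_left coeff_eq[symmetric]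
  by (simp add: power2_eq_square algebra_simps)

lemma \<phi>_nonzero: "q \<in> U \<Longrightarrow> \<phi> q \<noteq> 0"
  using K_nonzero by simp

text \<open>As nu is \<open>\<phi>\<close> times alpha_u x alpha_v, the triple product is
  \<open>\<phi>\<close> cubed times LN - M^2. Its nonvanishing makes the co-normal map an immersion
  and determines the affine normal.\<close>

lemma conormal_triple:
  assumes "q \<in> U"
  shows "\<nu> q \<bullet> cross3 (d_u \<nu> q) (d_v \<nu> q) \<noteq> 0"
proof -
  have "\<nu> q \<bullet> cross3 (d_u \<nu> q) (d_v \<nu> q) = \<phi> q * ((\<phi> q)\<^sup>2 * K q)"
    unfolding cross_conormal_dot_cross[OF assms, symmetric]
    by (simp add: conormal_def inner_commute)
  then show ?thesis using K_nonzero[OF assms] \<phi>_nonzero[OF assms] by simp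
qed

lemma cross_conormal_nonzero: "q \<in> U \<Longrightarrow> cross3 (d_u \<nu> q) (d_v \<nu> q) \<noteq> 0"
  using conormal_triple by force

text \<open>If the cross product vanished, so would nu and with it the triple product.\<close>

lemma cross_nonzero: "q \<in> U \<Longrightarrow> cross3 (d_u \<alpha> q) (d_v \<alpha> q) \<noteq> 0"
  using conormal_triple[of q] unfolding conormal_def by auto

lemma immersion_conormal: "immersion_on U \<nu>"
  unfolding immersion_on_def
  using inj_frechet_derivative_if_cross3 smooth_on_imp_differentiable[OF smooth_conormal]
    cross_conormal_nonzero by blast

text \<open>Orthogonality to nu_u and nu_v leaves the multiples of nu_u x nu_v, and <nu, xi> = 1
  fixes the factor. The formula replaces the description by \<open>THE\<close>, so that smoothness
  of \<open>\<xi>\<close> can be read off.\<close>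

lemma affine_normal_eq:
  assumes "q \<in> U"
  shows "\<xi> q = (1 / (\<nu> q \<bullet> cross3 (d_u \<nu> q) (d_v \<nu> q))) *\<^sub>R cross3 (d_u \<nu> q) (d_v \<nu> q)"
    (is "_ = ?x")
  unfolding affine_normal_def
proof (rule the_equality)
  show *: "\<nu> q \<bullet> ?x = 1 \<and> ?x \<bullet> d_u \<nu> q = 0 \<and> ?x \<bullet> d_v \<nu> q = 0"
    using conormal_triple[OF assms] by (simp add: dot_cross_self inner_commute)
  fix y assume y: "\<nu> q \<bullet> y = 1 \<and> y \<bullet> d_u \<nu> q = 0 \<and> y \<bullet> d_v \<nu> q = 0"
  have "y - ?x = 0"
    by (rule eq_0_if_orthogonal_independent[OF conormal_triple[OF assms]])
      (use * y in \<open>simp_all add: inner_diff_left inner_diff_right inner_commute\<close>)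
  then show "y = ?x" by simp
qed

section \<open>Smoothness and derivatives of the affine normal\<close>

lemma affine_normal_properties:
  assumes "q \<in> U"
  shows "\<nu> q \<bullet> \<xi> q = 1" "\<xi> q \<bullet> partial_deriv i \<nu> q = 0"
  using conormal_triple[OF assms] exhaust_2[of i] unfolding affine_normal_eq[OF assms]
  by (auto simp: dot_cross_self inner_commute)

lemma smooth_affine_normal: "smooth_on U \<xi>"
proof -
  let ?d = "\<lambda>q. \<nu> q \<bullet> cross3 (d_u \<nu> q) (d_v \<nu> q)"
  have pos: "0 < ?d q * ?d q" if "q \<in> U" for q
    using conormal_triple[OF that] zero_less_mult_iff[of "?d q" "?d q"] by linarith
  \<comment> \<open>A reciprocal of either sign is expressed by a power of the positive square,
    which the rule for real powers covers.\<close>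
  have inv: "1 / x = x * (x * x) powr - 1" if "x \<noteq> 0" for x :: real
    using that by (simp add: powr_minus divide_simps)
  let ?g = "\<lambda>q. (?d q * (?d q * ?d q) powr - 1) *\<^sub>R cross3 (d_u \<nu> q) (d_v \<nu> q)"
  have "smooth_on U ?g"
    using pos by (intro smooth_on_scaleR smooth_on_mult smooth_on_powr smooth_on_inner smooth_on_cross3
      smooth_on_partial_deriv open_domain smooth_conormal)
  moreover have "\<xi> q = ?g q" if "q \<in> U" for q
    unfolding affine_normal_eq[OF that] inv[OF conormal_triple[OF that]] ..
  then have "smooth_on U \<xi> \<longleftrightarrow> smooth_on U ?g" by (rule smooth_on_cong[OF open_domain])
  ultimately show ?thesis by (rule iffD2[rotated])
qed

text \<open>Differentiate <xi, nu_i> = 0 in the direction \<open>j\<close> and swap the partial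
  derivatives of nu. The symmetry <nu_u, xi_v> = <nu_v, xi_u> follows from the right side.\<close>

lemma deriv_conormal_deriv_affine_normal:
  assumes "q \<in> U"
  shows "partial_deriv i \<nu> q \<bullet> partial_deriv j \<xi> q = - (\<xi> q \<bullet> partial_deriv i (partial_deriv j \<nu>) q)"
proof -
  have "partial_deriv j \<xi> q \<bullet> partial_deriv i \<nu> q = - (\<xi> q \<bullet> partial_deriv j (partial_deriv i \<nu>) q)"
    using affine_normal_properties(2)
    by (rule partial_deriv_inner_const[OF open_domain smooth_affine_normal
          smooth_on_partial_deriv[OF smooth_conormal] assms])
  then show ?thesis
    using partial_deriv_commute[OF open_domain smooth_conormal assms] by (simp add: inner_commute)
qed

text \<open>Differentiating <nu, xi> = 1 and using <xi, nu_i> = 0 leaves <nu, xi_i> = 0: the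
  derivatives of the affine normal are tangent to S.\<close>

lemma deriv_affine_normal_orthogonal:
  assumes "q \<in> U"
  shows "partial_deriv i \<xi> q \<bullet> cross3 (d_u \<alpha> q) (d_v \<alpha> q) = 0"
proof -
  have "partial_deriv i \<nu> q \<bullet> \<xi> q = - (\<nu> q \<bullet> partial_deriv i \<xi> q)"
    using affine_normal_properties(1)
    by (rule partial_deriv_inner_const[OF open_domain smooth_conormal smooth_affine_normal assms])
  then have "\<nu> q \<bullet> partial_deriv i \<xi> q = 0"
    using affine_normal_properties(2)[OF assms, of i] by (simp add: inner_commute)
  then show ?thesis using \<phi>_nonzero[OF assms] unfolding conormal_def by (simp add: inner_commute)
qed

text \<open>The factor is \<open>-1 / \<bar>\<xi>\<bar>\<close> up to the sign of \<open>\<langle>\<nu>, \<nu>\<^sub>u \<and> \<nu>\<^sub>v\<rangle>\<close>, since \<open>\<xi>\<close> is normal to the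
  co-normal surface.\<close>

lemma unit_normal_conormal_inner:
  assumes "q \<in> U"
  obtains c where "c \<noteq> 0" and "\<And>i j. unit_normal \<nu> q \<bullet> partial_deriv i (partial_deriv j \<nu>) q
    = c * (partial_deriv i \<nu> q \<bullet> partial_deriv j \<xi> q)"
proof -
  let ?w = "cross3 (d_u \<nu> q) (d_v \<nu> q)"
  let ?c = "- (\<nu> q \<bullet> ?w) / norm ?w"
  show thesis
  proof
    show "?c \<noteq> 0" using conormal_triple[OF assms] cross_conormal_nonzero[OF assms] by simp
    show "unit_normal \<nu> q \<bullet> partial_deriv i (partial_deriv j \<nu>) q
        = ?c * (partial_deriv i \<nu> q \<bullet> partial_deriv j \<xi> q)" for i j
      unfolding deriv_conormal_deriv_affine_normal[OF assms]
      unfolding affine_normal_eq[OF assms] unit_normal_def sgn_div_norm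
      using conormal_triple[OF assms] by (simp add: divide_simps)
  qed
qed

text \<open>Both differentials are injective, so the two tangent vectors have the same coordinates
  \<open>h\<close>, in which the quadratic forms differ by a nonzero factor.\<close>

lemma third_form_iff_second_form:
  assumes "q \<in> U"
  shows "affine_third_form \<alpha> q (frechet_derivative \<alpha> (at q) h) = 0 \<longleftrightarrow>
    second_fundamental_form \<nu> q (frechet_derivative \<nu> (at q) h) = 0"
proof -
  obtain c where c: "c \<noteq> 0" "\<And>i j. unit_normal \<nu> q \<bullet> partial_deriv i (partial_deriv j \<nu>) q
      = c * (partial_deriv i \<nu> q \<bullet> partial_deriv j \<xi> q)"
    using unit_normal_conormal_inner[OF assms] by blast
  \<comment> \<open>The affine form expands into two separate mixed terms; their equality matches
    the doubled middle coefficient of the Euclidean form.\<close>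
  have sym: "d_v \<nu> q \<bullet> d_u \<xi> q = d_u \<nu> q \<bullet> d_v \<xi> q"
    unfolding deriv_conormal_deriv_affine_normal[OF assms]
      partial_deriv_commute[OF open_domain smooth_conormal assms, of 1 2] ..
  have \<alpha>: "tangent_coords \<alpha> q (frechet_derivative \<alpha> (at q) h) = h"
    and \<nu>: "tangent_coords \<nu> q (frechet_derivative \<nu> (at q) h) = h"
    using immersion immersion_conormal assms unfolding immersion_on_def
    by (auto intro: tangent_coords_frechet_derivative)
  have "second_fundamental_form \<nu> q (frechet_derivative \<nu> (at q) h)
      = c * affine_third_form \<alpha> q (frechet_derivative \<alpha> (at q) h)"
    unfolding second_fundamental_form_def affine_third_form_def surface_diff_def \<alpha> \<nu> Let_def c(2)
    unfolding frechet_derivative_real2[OF smooth_on_imp_differentiable[OF smooth_conormal assms]]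
      frechet_derivative_real2[OF smooth_on_imp_differentiable[OF smooth_affine_normal assms]]
    by (simp add: inner_add_left inner_add_right sym power2_eq_square algebra_simps)
  then show ?thesis using c(1) by simp
qed

text \<open>A Weingarten equation: xi_j is tangent, and injectivity of the differential identifies
  its coordinates with column \<open>j\<close> of the shape matrix.\<close>

lemma affine_shape_matrix_column:
  assumes "q \<in> U"
  shows "partial_deriv j \<xi> q
    = affine_shape_matrix \<alpha> q $ 1 $ j *\<^sub>R d_u \<alpha> q + affine_shape_matrix \<alpha> q $ 2 $ j *\<^sub>R d_v \<alpha> q"
proof -
  have inj: "inj (frechet_derivative \<alpha> (at q))"
    using immersion assms unfolding immersion_on_def by blast
  obtain s t where st: "partial_deriv j \<xi> q = s *\<^sub>R d_u \<alpha> q + t *\<^sub>R d_v \<alpha> q"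
    using orthogonal_cross3_in_span[OF cross_nonzero[OF assms] deriv_affine_normal_orthogonal[OF assms]] .
  have "partial_deriv j \<xi> q = frechet_derivative \<alpha> (at q) (vector [s, t])"
    unfolding st frechet_derivative_real2[OF smooth_on_imp_differentiable[OF smooth assms]] by simp
  then have "affine_shape_matrix \<alpha> q $ i $ j = (vector [s, t] :: real^2) $ i" for i
    unfolding affine_shape_matrix_def matrix_def surface_diff_def
      tangent_coords_frechet_derivative[OF inj]
    unfolding partial_deriv_def
    by (simp add: tangent_coords_frechet_derivative[OF inj])
  then show ?thesis using st by simp
qed

text \<open>By Lagrange's identity ln - m^2 is <nu_u x nu_v, xi_u x xi_v>, a nonzero multiple of the
  determinant of the shape matrix. The Gaussian curvature of the co-normal surface is in turn a
  nonzero multiple of ln - m^2.\<close>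

lemma affine_parabolic_iff_gaussian_curvature:
  assumes "q \<in> U"
  shows "affine_parabolic \<alpha> q \<longleftrightarrow> gaussian_curvature \<nu> q = 0"
proof -
  obtain c where c: "c \<noteq> 0" "\<And>i j. unit_normal \<nu> q \<bullet> partial_deriv i (partial_deriv j \<nu>) q
      = c * (partial_deriv i \<nu> q \<bullet> partial_deriv j \<xi> q)"
    using unit_normal_conormal_inner[OF assms] by blast
  let ?S = "affine_shape_matrix \<alpha> q" and ?w = "cross3 (d_u \<nu> q) (d_v \<nu> q)"
  have sym: "d_u \<nu> q \<bullet> d_v \<xi> q = d_v \<nu> q \<bullet> d_u \<xi> q"
    unfolding deriv_conormal_deriv_affine_normal[OF assms]
      partial_deriv_commute[OF open_domain smooth_conormal assms, of 1 2] ..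
  have "cross3 (d_u \<xi> q) (d_v \<xi> q) = det ?S *\<^sub>R cross3 (d_u \<alpha> q) (d_v \<alpha> q)"
    unfolding affine_shape_matrix_column[OF assms] cross3_linear_combinations det_2
    by (simp add: mult.commute)
  then have S: "(d_u \<nu> q \<bullet> d_u \<xi> q) * (d_v \<nu> q \<bullet> d_v \<xi> q) - (d_v \<nu> q \<bullet> d_u \<xi> q)\<^sup>2
      = det ?S * ((\<phi> q)\<^sup>2 * K q)"
    unfolding cross_conormal_dot_cross[OF assms, symmetric] unfolding power2_eq_square
    using dot_cross[of "d_u \<nu> q" "d_v \<nu> q" "d_u \<xi> q" "d_v \<xi> q"] sym by simp
  have EG: "(d_u \<nu> q \<bullet> d_u \<nu> q) * (d_v \<nu> q \<bullet> d_v \<nu> q) - (d_u \<nu> q \<bullet> d_v \<nu> q)\<^sup>2 = (norm ?w)\<^sup>2"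
    unfolding norm_cross unfolding power2_norm_eq_inner ..
  \<comment> \<open>Each coefficient of the second fundamental form carries one factor
    \<open>c\<close>, hence the square.\<close>
  have "gaussian_curvature \<nu> q = c\<^sup>2 * ((d_u \<nu> q \<bullet> d_u \<xi> q) * (d_v \<nu> q \<bullet> d_v \<xi> q)
      - (d_v \<nu> q \<bullet> d_u \<xi> q)\<^sup>2) / (norm ?w)\<^sup>2"
    unfolding gaussian_curvature_def Let_def c(2) EG
    by (rule arg_cong[where f = "\<lambda>x. x / (norm ?w)\<^sup>2"]) (simp add: power2_eq_square algebra_simps)
  then show ?thesis
    unfolding S affine_parabolic_def
    using c(1) cross_conormal_nonzero[OF assms] K_nonzero[OF assms] \<phi>_nonzero[OF assms] by simp
qed

text \<open>Both image curves are regular since both maps are immersions, and their velocities are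
  images of the same vector. What remains at each \<open>t\<close> is to compare the zeros of the
  two forms.\<close>

lemma affine_asymptotic_line_iff:
  assumes "is_interval I" "interior I \<noteq> {}" "\<gamma> ` I \<subseteq> U" "regular_curve I \<gamma>"
  shows "affine_asymptotic_line \<alpha> I \<gamma> \<longleftrightarrow> asymptotic_line \<nu> I \<gamma>"
proof -
  have reg: "regular_curve I (\<alpha> \<circ> \<gamma>)" "regular_curve I (\<nu> \<circ> \<gamma>)"
    using regular_curve_immersion assms smooth immersion smooth_conormal immersion_conormal by blast+
  have "affine_asymptotic_direction \<alpha> (\<gamma> t) (vector_derivative (\<alpha> \<circ> \<gamma>) (at t within I)) \<longleftrightarrow>
      asymptotic_direction \<nu> (\<gamma> t) (vector_derivative (\<nu> \<circ> \<gamma>) (at t within I))" if "t \<in> I" for t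
  proof -
    have "vector_derivative (\<alpha> \<circ> \<gamma>) (at t within I) \<noteq> 0" "vector_derivative (\<nu> \<circ> \<gamma>) (at t within I) \<noteq> 0"
      using reg that unfolding regular_curve_def by blast+
    then show ?thesis
      using third_form_iff_second_form[of "\<gamma> t"] that assms(3)
      unfolding affine_asymptotic_direction_def asymptotic_direction_def tangent_space_def
        vector_derivative_surface_curve(2)[OF assms(1,2) smooth assms(3,4) that]
        vector_derivative_surface_curve(2)[OF assms(1,2) smooth_conormal assms(3,4) that]
      by auto
  qed
  then show ?thesis unfolding affine_asymptotic_line_def asymptotic_line_def using reg by simp
qed

end

theorem theorem3p3:
  fixes U :: "(real^2) set" and \<alpha> :: "real^2 \<Rightarrow> real^3"
    and I :: "real set" and \<gamma> :: "real \<Rightarrow> real^2"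
  assumes "open U" and "smooth_on U \<alpha>" and "immersion_on U \<alpha>"
    and "\<forall>q\<in>U. \<not> euclidean_parabolic \<alpha> q"
    and "is_interval I" and "interior I \<noteq> {}"
    and "\<gamma> ` I \<subseteq> U" and "regular_curve I \<gamma>"
  shows "(affine_asymptotic_line \<alpha> I \<gamma> \<longleftrightarrow> asymptotic_line (conormal \<alpha>) I \<gamma>) \<and>
    (\<forall>q\<in>U. affine_parabolic \<alpha> q \<longleftrightarrow> gaussian_curvature (conormal \<alpha>) q = 0)"
proof -
  interpret nonparabolic_surface U \<alpha>
    using assms(1-4) by unfold_locales auto
  show ?thesis
    using affine_asymptotic_line_iff[OF assms(5-8)] affine_parabolic_iff_gaussian_curvature by blast
qed

end
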